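(* Let $G$ be a graph on $n$ vertices with degree sequence $d_1\ge d_2\ge\cdots\ge d_n$ and let $m=\max\{i:d_i\ge i-1\}$. Then $G$ is an NG-1 graph if and only if (1) $\sum_{i=1}^m d_i = m(m-1)+\sum_{i=m+1}^n d_i$, and (2) $d_m=m-1$ and $m$ is the largest index $i$ with $d_i=m-1$. Similarly, $G$ is an NG-2 graph if and only if (1) holds and (2') $d_m=m-1$ and $m$ is the smallest index $i$ with $d_i=m-1$.
   Context: Graphs are finite and simple; $\chi$ is the chromatic number and $\overline{G}$ the complement. A graph $G$ is an NG-graph if $\chi(G)+\chi(\overline{G})=|V(G)|+1$. The ABC-partition of $V(G)$ is $A=\{v:\deg(v)=\chi(G)-1\}$, $B=\{v:\deg(v)>\chi(G)-1\}$, $C=\{v:\deg(v)<\chi(G)-1\}$. An NG-1 graph is an NG-graph in which $G[A]$ is a clique; an NG-2 graph is an NG-graph in which $G[A]$ is a stable set. *)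

theory Defs
  imports "Graph_Theory.Pair_Digraph"
begin

text \<open>
  A finite simple graph is a \<open>pair_graph\<close>: a finite, loop-free, symmetric set of pairs over a
  finite vertex set.  Each undirected edge is stored as two opposite arcs, so the degree of a
  vertex is its \<open>out_degree\<close>.
\<close>

definition complement :: "'a pair_pre_digraph \<Rightarrow> 'a pair_pre_digraph" where
  "complement G =
     \<lparr> pverts = pverts G,
       parcs = {(u, v). u \<in> pverts G \<and> v \<in> pverts G \<and> u \<noteq> v \<and> (u, v) \<notin> parcs G} \<rparr>"

definition proper_coloring :: "'a pair_pre_digraph \<Rightarrow> nat \<Rightarrow> ('a \<Rightarrow> nat) \<Rightarrow> bool" where
  "proper_coloring G k c \<longleftrightarrow>
     (\<forall>v \<in> pverts G. c v < k) \<and> (\<forall>(u, v) \<in> parcs G. c u \<noteq> c v)"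

definition chromatic_number :: "'a pair_pre_digraph \<Rightarrow> nat" where
  "chromatic_number G = (LEAST k. \<exists>c. proper_coloring G k c)"

definition degree :: "'a pair_pre_digraph \<Rightarrow> 'a \<Rightarrow> nat" where
  "degree G v = out_degree (with_proj G) v"

definition induces_clique :: "'a pair_pre_digraph \<Rightarrow> 'a set \<Rightarrow> bool" where
  "induces_clique G S \<longleftrightarrow> (\<forall>u \<in> S. \<forall>v \<in> S. u \<noteq> v \<longrightarrow> (u, v) \<in> parcs G)"

definition induces_stable :: "'a pair_pre_digraph \<Rightarrow> 'a set \<Rightarrow> bool" where
  "induces_stable G S \<longleftrightarrow> (\<forall>u \<in> S. \<forall>v \<in> S. (u, v) \<notin> parcs G)"

definition NG_graph :: "'a pair_pre_digraph \<Rightarrow> bool" where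
  "NG_graph G \<longleftrightarrow>
     chromatic_number G + chromatic_number (complement G) = card (pverts G) + 1"

text \<open>
  The part \<open>A\<close> of the ABC-partition.  The truncated subtraction is harmless, since a graph
  with a vertex has chromatic number at least 1.
\<close>

definition ABC_A :: "'a pair_pre_digraph \<Rightarrow> 'a set" where
  "ABC_A G = {v \<in> pverts G. degree G v = chromatic_number G - 1}"

definition NG1_graph :: "'a pair_pre_digraph \<Rightarrow> bool" where
  "NG1_graph G \<longleftrightarrow> NG_graph G \<and> induces_clique G (ABC_A G)"

definition NG2_graph :: "'a pair_pre_digraph \<Rightarrow> bool" where
  "NG2_graph G \<longleftrightarrow> NG_graph G \<and> induces_stable G (ABC_A G)"

text \<open>
  \<open>d 1 \<ge> d 2 \<ge> \<dots> \<ge> d n\<close> lists the vertex degrees with multiplicity; values of \<open>d\<close> outside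
  \<open>{1..n}\<close> are irrelevant.
\<close>

definition degree_sequence :: "'a pair_pre_digraph \<Rightarrow> nat \<Rightarrow> (nat \<Rightarrow> nat) \<Rightarrow> bool" where
  "degree_sequence G n d \<longleftrightarrow>
     (\<exists>v. bij_betw v {1..n} (pverts G) \<and> (\<forall>i \<in> {1..n}. d i = degree G (v i))) \<and>
     (\<forall>i \<in> {1..n}. \<forall>j \<in> {1..n}. i \<le> j \<longrightarrow> d i \<ge> d j)"

end

theory Submission
  imports Defs
begin

text \<open>
  Vertices of degree less than \<open>\<chi>(G) - 1\<close> can be coloured greedily at the end, so
  \<open>\<chi>(G)\<close> is at most the number of colours of any proper colouring of \<open>A \<union> B\<close>; dually
  \<open>\<chi>\<close> of the complement is bounded by colourings of \<open>A \<union> C\<close>.  If \<open>A\<close> is a clique, it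
  needs only one colour in the complement, and equality in \<open>\<chi>(G) + \<chi>(complement G) = n + 1\<close>
  forces \<open>A\<close> to be nonempty, \<open>A \<union> B\<close> to be a clique of size \<open>\<chi>(G)\<close>, and \<open>C\<close> to be stable.
  The case of stable \<open>A\<close> follows by complementation.  Finally, for a set \<open>K\<close> of \<open>m\<close>
  vertices, condition (1) says exactly that \<open>K\<close> is a clique with stable rest
  (the splittance formula of Hammer and Simeone).
\<close>

section \<open>Degrees and complements\<close>

lemma degree_eq_card: "degree G v = card {w. (v, w) \<in> parcs G}"
proof -
  have "out_arcs (with_proj G) v = Pair v ` {w. (v, w) \<in> parcs G}"
    by (auto simp: out_arcs_def)
  thus ?thesis
    by (simp add: degree_def out_degree_def card_image inj_on_def)
qed

lemma pair_graph_arcs: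
  assumes "pair_graph G"
  shows "finite (pverts G)"
    and "(u, w) \<in> parcs G \<Longrightarrow> u \<in> pverts G"
    and "(u, w) \<in> parcs G \<Longrightarrow> w \<in> pverts G"
    and "(u, w) \<in> parcs G \<Longrightarrow> u \<noteq> w"
    and "(u, w) \<in> parcs G \<longleftrightarrow> (w, u) \<in> parcs G"
proof -
  interpret pair_graph G by fact
  show "finite (pverts G)" by simp
  show "(u, w) \<in> parcs G \<Longrightarrow> u \<in> pverts G" "(u, w) \<in> parcs G \<Longrightarrow> w \<in> pverts G"
    by (auto dest: in_arcsD1 in_arcsD2)
  show "(u, w) \<in> parcs G \<Longrightarrow> u \<noteq> w"
    using no_loops' by auto
  show "(u, w) \<in> parcs G \<longleftrightarrow> (w, u) \<in> parcs G"
    using arcs_symmetric by blast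
qed

lemma complement_simps [simp]:
  "pverts (complement G) = pverts G"
  "(u, w) \<in> parcs (complement G) \<longleftrightarrow>
     u \<in> pverts G \<and> w \<in> pverts G \<and> u \<noteq> w \<and> (u, w) \<notin> parcs G"
  by (auto simp: complement_def)

lemma pair_graph_complement:
  assumes "pair_graph G"
  shows "pair_graph (complement G)"
proof -
  have "parcs (complement G) \<subseteq> pverts G \<times> pverts G"
    by (auto simp: complement_def)
  hence "finite (parcs (complement G))"
    using pair_graph_arcs(1)[OF assms] finite_subset by blast
  moreover have "sym (parcs (complement G))"
    using pair_graph_arcs(5)[OF assms] by (auto intro!: symI)
  ultimately show ?thesis
    using pair_graph_arcs(1)[OF assms]
    by unfold_locales (auto simp: symmetric_def)
qed

lemma complement_complement:
  assumes "pair_graph G"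
  shows "complement (complement G) = G"
proof -
  have "parcs (complement (complement G)) = parcs G"
    using pair_graph_arcs(2-4)[OF assms] by auto
  thus ?thesis
    by simp
qed

lemma degree_complement:
  assumes "pair_graph G" "v \<in> pverts G"
  shows "degree (complement G) v + degree G v + 1 = card (pverts G)"
proof -
  note arcs = pair_graph_arcs[OF assms(1)]
  let ?N = "{w. (v, w) \<in> parcs G}" and ?M = "{w. (v, w) \<in> parcs (complement G)}"
  have eq: "pverts G = insert v (?M \<union> ?N)"
    using arcs(2-4) assms(2) by auto
  have fin: "finite ?M" "finite ?N"
    using arcs(1,3) by (auto intro: finite_subset[of _ "pverts G"])
  have "card (pverts G) = card (insert v (?M \<union> ?N))"
    by (rule arg_cong[OF eq])
  also have "card (insert v (?M \<union> ?N)) = Suc (card (?M \<union> ?N))"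
    using fin arcs(4) by (intro card_insert_disjoint) auto
  also have "card (?M \<union> ?N) = card ?M + card ?N"
    using fin by (intro card_Un_disjoint) auto
  finally show ?thesis
    by (simp add: degree_eq_card)
qed

section \<open>Bounds for the chromatic number\<close>

lemma chromatic_number_le: "proper_coloring G k c \<Longrightarrow> chromatic_number G \<le> k"
  unfolding chromatic_number_def by (rule Least_le) blast

text \<open>Colour the vertices outside \<open>R\<close> one at a time, in any order: each has fewer
  than \<open>k\<close> neighbours in all of \<open>G\<close>, so some colour below \<open>k\<close>
  is always free.\<close>

lemma greedy_extension:
  assumes G: "pair_graph G" and "R \<subseteq> pverts G"
    and low: "\<And>v. v \<in> pverts G - R \<Longrightarrow> degree G v < k"
    and "\<And>v. v \<in> R \<Longrightarrow> c v < k"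
    and "\<And>u w. u \<in> R \<Longrightarrow> w \<in> R \<Longrightarrow> (u, w) \<in> parcs G \<Longrightarrow> c u \<noteq> c w"
  shows "\<exists>c'. proper_coloring G k c'"
proof -
  note arcs = pair_graph_arcs[OF G]
  have fin: "finite (pverts G - R)"
    using arcs(1) by simp
  have "\<exists>c'. (\<forall>v\<in>R \<union> T. c' v < k) \<and>
      (\<forall>u\<in>R \<union> T. \<forall>w\<in>R \<union> T. (u, w) \<in> parcs G \<longrightarrow> c' u \<noteq> c' w)"
    if "finite T" "T \<subseteq> pverts G - R" for T
    using that
  proof (induction T)
    case empty
    show ?case
      using assms(4,5) by auto
  next
    case (insert x T)
    then obtain c' where c': "\<forall>v\<in>R \<union> T. c' v < k"
      "\<forall>u\<in>R \<union> T. \<forall>w\<in>R \<union> T. (u, w) \<in> parcs G \<longrightarrow> c' u \<noteq> c' w"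
      by auto
    \<comment> \<open>\<open>?N\<close> may contain vertices not coloured yet; the arbitrary values
      of \<open>c'\<close> there only block further colours, and fewer than \<open>k\<close> are
      blocked in any case.\<close>
    let ?N = "{w. (x, w) \<in> parcs G}"
    have "finite ?N"
      using arcs(1,3) by (auto intro: finite_subset)
    hence "card (c' ` ?N) \<le> card ?N" "finite (c' ` ?N)"
      by (auto intro: card_image_le)
    moreover have "card ?N < k"
      using low[of x] insert.prems by (simp add: degree_eq_card)
    ultimately have "\<not> {..<k} \<subseteq> c' ` ?N"
      using card_mono[of "c' ` ?N" "{..<k}"] by auto
    then obtain i where i: "i < k" "i \<notin> c' ` ?N"
      by auto
    have fresh: "c' w \<noteq> i" if "(x, w) \<in> parcs G \<or> (w, x) \<in> parcs G" for w
      using i(2) arcs(5)[of w x] that by auto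
    have "(c'(x := i)) u \<noteq> (c'(x := i)) w"
      if "u \<in> R \<union> insert x T" "w \<in> R \<union> insert x T" "(u, w) \<in> parcs G" for u w
      using c'(2) that fresh[of u] fresh[of w] arcs(4)[OF that(3)] by auto
    moreover have "\<forall>v\<in>R \<union> insert x T. (c'(x := i)) v < k"
      using c'(1) i(1) by auto
    ultimately show ?case
      by (intro exI[of _ "c'(x := i)"]) blast
  qed
  from this[OF fin] obtain c' where
    "\<forall>v\<in>R \<union> (pverts G - R). c' v < k"
    "\<forall>u\<in>R \<union> (pverts G - R). \<forall>w\<in>R \<union> (pverts G - R). (u, w) \<in> parcs G \<longrightarrow> c' u \<noteq> c' w"
    by auto
  hence "proper_coloring G k c'"
    using arcs(2,3) \<open>R \<subseteq> pverts G\<close> unfolding proper_coloring_def by blast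
  thus ?thesis
    by blast
qed

text \<open>Outside \<open>R\<close> all degrees are below \<chi>(G) - 1, so the colouring
  \<open>f\<close> extends greedily with \<open>?k\<close> colours, the maximum of the number of
  values of \<open>f\<close> and \<chi>(G) - 1. Unless \<chi>(G) = 0, the latter number is too
  small, so the former is at least \<chi>(G).\<close>

lemma chromatic_number_le_card_image:
  assumes G: "pair_graph G" and R: "R \<subseteq> pverts G"
    and high: "{v \<in> pverts G. chromatic_number G - 1 \<le> degree G v} \<subseteq> R"
    and f: "\<And>u w. u \<in> R \<Longrightarrow> w \<in> R \<Longrightarrow> (u, w) \<in> parcs G \<Longrightarrow> f u \<noteq> f w"
  shows "chromatic_number G \<le> card (f ` R)"
proof -
  have "finite (f ` R)"
    using pair_graph_arcs(1)[OF G] R finite_subset by blast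
  \<comment> \<open>The values of \<open>f\<close> have arbitrary type; \<open>g\<close> renumbers
    them as an initial segment of the naturals.\<close>
  then obtain g where g: "bij_betw g (f ` R) {..<card (f ` R)}"
    using ex_bij_betw_finite_nat lessThan_atLeast0 by metis
  let ?k = "max (card (f ` R)) (chromatic_number G - 1)"
  have "\<exists>c. proper_coloring G ?k c"
  proof (rule greedy_extension[OF G R, where c = "g \<circ> f"])
    show "degree G v < ?k" if "v \<in> pverts G - R" for v
      using high that by fastforce
    show "(g \<circ> f) v < ?k" if "v \<in> R" for v
      using bij_betwE[OF g] that by fastforce
    show "(g \<circ> f) u \<noteq> (g \<circ> f) w" if "u \<in> R" "w \<in> R" "(u, w) \<in> parcs G" for u w
      using f[OF that] bij_betw_imp_inj_on[OF g] that(1,2) by (auto dest: inj_onD)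
  qed
  hence "chromatic_number G \<le> ?k"
    using chromatic_number_le by blast
  thus ?thesis
    by linarith
qed

lemma chromatic_number_le_card:
  assumes "pair_graph G" "R \<subseteq> pverts G"
    and "{v \<in> pverts G. chromatic_number G - 1 \<le> degree G v} \<subseteq> R"
  shows "chromatic_number G \<le> card R"
  using chromatic_number_le_card_image[OF assms, of id] pair_graph_arcs(4)[OF assms(1)] by auto

text \<open>\<open>T\<close> shares one colour and every other vertex of \<open>R\<close> has its
  own, which saves |T| - 1 colours.\<close>

lemma chromatic_number_add_card_stable_le:
  assumes G: "pair_graph G" and R: "R \<subseteq> pverts G"
    and high: "{v \<in> pverts G. chromatic_number G - 1 \<le> degree G v} \<subseteq> R"
    and T: "T \<subseteq> R" "T \<noteq> {}" "induces_stable G T"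
  shows "chromatic_number G + card T \<le> card R + 1"
proof -
  have fin: "finite R"
    using pair_graph_arcs(1)[OF G] R finite_subset by blast
  obtain t where t: "t \<in> T"
    using T(2) by blast
  let ?f = "\<lambda>v. if v \<in> T then t else v"
  have "chromatic_number G \<le> card (?f ` R)"
    using T(3) t pair_graph_arcs(4)[OF G]
    by (intro chromatic_number_le_card_image[OF G R high])
      (auto simp: induces_stable_def split: if_splits)
  also have "\<dots> \<le> card (insert t (R - T))"
    using fin by (intro card_mono) auto
  also have "\<dots> \<le> Suc (card R - card T)"
    using fin T(1) by (simp add: card_insert_if card_Diff_subset finite_subset)
  finally show ?thesis
    using card_mono[OF fin T(1)] by simp
qed

text \<open>Guarantees that the \<open>LEAST\<close> in \<open>chromatic_number_def\<close> is
  attained: greedy colouring from the empty set works, as every degree is below the number of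
  vertices.\<close>

lemma ex_proper_coloring:
  assumes "pair_graph G"
  shows "\<exists>c. proper_coloring G (chromatic_number G) c"
proof -
  have "\<exists>c. proper_coloring G (Suc (card (pverts G))) c"
  proof (rule greedy_extension[OF assms, where R = "{}" and c = undefined])
    show "degree G v < Suc (card (pverts G))" if "v \<in> pverts G - {}" for v
      using degree_complement[OF assms, of v] that by simp
  qed auto
  thus ?thesis
    unfolding chromatic_number_def by (rule LeastI)
qed

lemma card_clique_le_chromatic_number:
  assumes "pair_graph G" "K \<subseteq> pverts G" "induces_clique G K"
  shows "card K \<le> chromatic_number G"
proof -
  obtain c where c: "proper_coloring G (chromatic_number G) c"
    using ex_proper_coloring[OF assms(1)] ..
  have "inj_on c K"
    using c assms(3) unfolding proper_coloring_def induces_clique_def inj_on_def by blast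
  moreover have "c ` K \<subseteq> {..<chromatic_number G}"
    using c assms(2) by (auto simp: proper_coloring_def)
  ultimately show ?thesis
    using card_inj_on_le[of c K "{..<chromatic_number G}"] by simp
qed

section \<open>Structure of NG-graphs\<close>

lemma NG_graph_complement:
  assumes "pair_graph G"
  shows "NG_graph (complement G) \<longleftrightarrow> NG_graph G"
  by (simp add: NG_graph_def complement_complement[OF assms] add.commute)

lemma chromatic_number_le_order:
  assumes "pair_graph G"
  shows "chromatic_number G \<le> card (pverts G)"
  using chromatic_number_le_card[OF assms, of "pverts G"] by auto

text \<open>The two degrees of \<open>v\<close> sum to n - 1, and in an NG-graph so do the two
  thresholds \<chi> - 1. Since each \<chi> is at most n, the other is at least 1, so the
  subtractions are not truncated.\<close>

lemma NG_high_complement_iff: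
  assumes "pair_graph G" "NG_graph G" "v \<in> pverts G"
  shows "chromatic_number (complement G) - 1 \<le> degree (complement G) v \<longleftrightarrow>
         degree G v \<le> chromatic_number G - 1"
  using chromatic_number_le_order[OF assms(1)]
    chromatic_number_le_order[OF pair_graph_complement[OF assms(1)]]
    degree_complement[OF assms(1,3)] assms(2)
  unfolding NG_graph_def by simp linarith

text \<open>The same two sums show that complementation fixes A, while it exchanges B and C; this
  makes NG-1 and NG-2 dual.\<close>

lemma ABC_A_complement:
  assumes "pair_graph G" "NG_graph G"
  shows "ABC_A (complement G) = ABC_A G"
proof -
  have "degree (complement G) v = chromatic_number (complement G) - 1 \<longleftrightarrow>
        degree G v = chromatic_number G - 1" if "v \<in> pverts G" for v
    using chromatic_number_le_order[OF assms(1)]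
      chromatic_number_le_order[OF pair_graph_complement[OF assms(1)]]
      degree_complement[OF assms(1) that] assms(2)
    unfolding NG_graph_def by simp linarith
  thus ?thesis
    by (auto simp: ABC_A_def)
qed

text \<open>Here \<open>D\<close> is A \<union> B. \<open>G\<close> needs at most |D| colours and
  the complement at most n - |D| + 1, because A costs one colour there. These bounds sum to n + 1,
  so neither can be improved; a non-edge in \<open>D\<close> or an edge in C would improve
  one.\<close>

lemma NG1_structure:
  assumes G: "pair_graph G" and "NG1_graph G"
  defines "D \<equiv> {v \<in> pverts G. chromatic_number G - 1 \<le> degree G v}"
  shows "ABC_A G \<noteq> {}" "card D = chromatic_number G" "induces_clique G D"
    "induces_stable G (pverts G - D)"
proof -
  note arcs = pair_graph_arcs[OF G]
  note G' = pair_graph_complement[OF G]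
  let ?H = "complement G" and ?A = "ABC_A G"
  let ?D' = "{v \<in> pverts ?H. chromatic_number ?H - 1 \<le> degree ?H v}"
  have NG: "NG_graph G" and clique_A: "induces_clique G ?A"
    using assms(2) by (auto simp: NG1_graph_def)
  have sum: "chromatic_number G + chromatic_number ?H = card (pverts G) + 1"
    using NG by (simp add: NG_graph_def)
  have D: "D \<subseteq> pverts G" and AD: "?A \<subseteq> D"
    by (auto simp: D_def ABC_A_def)
  \<comment> \<open>The high-degree vertices of the complement are those of C \<union> A.\<close>
  have D': "?D' = (pverts G - D) \<union> ?A"
    using NG_high_complement_iff[OF G NG] by (auto simp: D_def ABC_A_def)
  have fin: "finite D" "finite ?A" "finite (pverts G - D)"
    using arcs(1) finite_subset[OF D arcs(1)] finite_subset[OF AD] by auto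
  have card_V: "card (pverts G) = card D + card (pverts G - D)"
    using card_Diff_subset[OF fin(1) D] card_mono[OF arcs(1) D] by simp
  have card_D': "card ?D' = card (pverts G - D) + card ?A"
    unfolding D' using fin AD by (intro card_Un_disjoint) auto
  have le_D: "chromatic_number G \<le> card D"
    by (rule chromatic_number_le_card[OF G D]) (simp add: D_def)
  have "chromatic_number ?H \<le> card ?D'"
    by (rule chromatic_number_le_card[OF G']) auto
  \<comment> \<open>With A empty, the two bounds would sum to |D| + |C| = n only.\<close>
  hence "card ?A \<noteq> 0"
    using sum card_V card_D' le_D by linarith
  thus ne: "?A \<noteq> {}"
    by auto
  have "chromatic_number ?H + card ?A \<le> card ?D' + 1"
    using ne clique_A D'
    by (intro chromatic_number_add_card_stable_le[OF G'])
      (auto simp: induces_stable_def induces_clique_def)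
  thus card_D: "card D = chromatic_number G"
    using sum card_V card_D' le_D by linarith
  show "induces_clique G D"
  proof (rule ccontr)
    assume "\<not> induces_clique G D"
    then obtain u w where uw: "u \<in> D" "w \<in> D" "u \<noteq> w" "(u, w) \<notin> parcs G"
      by (auto simp: induces_clique_def)
    \<comment> \<open>A non-adjacent pair sharing a colour would push \<chi>(G) below |D|.\<close>
    have "chromatic_number G + card {u, w} \<le> card D + 1"
      using uw arcs(4,5)
      by (intro chromatic_number_add_card_stable_le[OF G D])
        (auto simp: induces_stable_def D_def)
    thus False
      using uw(3) card_D by simp
  qed
  show "induces_stable G (pverts G - D)"
  proof (rule ccontr)
    assume "\<not> induces_stable G (pverts G - D)"
    then obtain u w where uw: "u \<in> pverts G - D" "w \<in> pverts G - D" "(u, w) \<in> parcs G"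
      by (auto simp: induces_stable_def)
    obtain a where a: "a \<in> ?A"
      using ne by blast
    \<comment> \<open>In the complement, the stable sets \<open>A\<close> and \<open>{u, w}\<close> each need only one colour.\<close>
    let ?f = "\<lambda>v. if v \<in> ?A then a else if v = u then w else v"
    have "chromatic_number ?H \<le> card (?f ` ?D')"
    proof (rule chromatic_number_le_card_image[OF G'])
      show "?f x \<noteq> ?f y" if "x \<in> ?D'" "y \<in> ?D'" "(x, y) \<in> parcs ?H" for x y
        using that D' a AD uw clique_A arcs(5)[of u w]
        by (auto simp: induces_clique_def split: if_splits)
    qed auto
    \<comment> \<open>The remaining colours are \<open>a\<close> and C without \<open>u\<close>: at
      most |C|, whereas the NG equation demands |C| + 1.\<close>
    also have "\<dots> \<le> card (insert a (pverts G - D - {u}))"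
      unfolding D' using fin uw AD arcs(4) by (intro card_mono) auto
    also have "\<dots> \<le> Suc (card (pverts G - D - {u}))"
      using fin by (simp add: card_insert_if)
    also have "\<dots> = card (pverts G - D)"
      using fin uw by (intro card.remove[symmetric]) auto
    finally show False
      using sum card_D card_V by linarith
  qed
qed

text \<open>\<open>NG1_structure\<close> applied to the complement, whose high-degree vertices A
  \<union> C are the vertices outside \<open>B\<close>. Their number n + 1 - \<chi>(G) leaves
  \<chi>(G) - 1 for \<open>B\<close>.\<close>

lemma NG2_structure:
  assumes G: "pair_graph G" and "NG2_graph G"
  defines "B \<equiv> {v \<in> pverts G. chromatic_number G - 1 < degree G v}"
  shows "ABC_A G \<noteq> {}" "card B + 1 = chromatic_number G" "induces_clique G B"
    "induces_stable G (pverts G - B)"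
proof -
  note arcs = pair_graph_arcs[OF G]
  let ?H = "complement G"
  let ?D = "{v \<in> pverts ?H. chromatic_number ?H - 1 \<le> degree ?H v}"
  have NG: "NG_graph G" and stable_A: "induces_stable G (ABC_A G)"
    using assms(2) by (auto simp: NG2_graph_def)
  have "ABC_A G \<subseteq> pverts G"
    by (auto simp: ABC_A_def)
  hence "NG1_graph ?H"
    using NG stable_A NG_graph_complement[OF G] ABC_A_complement[OF G NG]
    by (auto simp: NG1_graph_def induces_clique_def induces_stable_def)
  note str = NG1_structure[OF pair_graph_complement[OF G] this]
  have D: "?D = pverts G - B"
    using NG_high_complement_iff[OF G NG] by (auto simp: B_def)
  have B: "B \<subseteq> pverts G"
    by (auto simp: B_def)
  show "ABC_A G \<noteq> {}"
    using str(1) ABC_A_complement[OF G NG] by simp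
  have "card (pverts G - B) = chromatic_number ?H"
    using str(2) unfolding D .
  moreover have "card (pverts G - B) + card B = card (pverts G)"
    using card_Diff_subset[OF finite_subset[OF B arcs(1)] B] card_mono[OF arcs(1) B] by simp
  ultimately show "card B + 1 = chromatic_number G"
    using NG unfolding NG_graph_def by linarith
  show "induces_clique G B"
    using str(4) B unfolding D by (auto simp: induces_clique_def induces_stable_def)
  show "induces_stable G (pverts G - B)"
    using str(3) arcs(4) unfolding D by (auto simp: induces_clique_def induces_stable_def)
qed

section \<open>Split graphs\<close>

lemma sum_degree_eq_card_arcs:
  assumes "pair_graph G" "S \<subseteq> pverts G"
  shows "(\<Sum>v\<in>S. degree G v) = card (parcs G \<inter> S \<times> pverts G)"
proof -
  note arcs = pair_graph_arcs[OF assms(1)]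
  have "parcs G \<inter> S \<times> pverts G = Sigma S (\<lambda>v. {w. (v, w) \<in> parcs G})"
    using arcs(3) by auto
  moreover have "finite S" "finite {w. (v, w) \<in> parcs G}" for v
    using arcs(1,3) assms(2) by (auto intro: finite_subset)
  ultimately show ?thesis
    by (simp add: degree_eq_card)
qed

text \<open>Count arcs: those between \<open>K\<close> and the rest contribute equally to both
  degree sums and cancel. What remains says that the number of arcs missing inside \<open>K\<close>
  plus the number of arcs inside the rest is 0.\<close>

lemma split_iff_sum_degree:
  assumes G: "pair_graph G" and K: "K \<subseteq> pverts G"
  shows "(\<Sum>v\<in>K. degree G v) = card K * (card K - 1) + (\<Sum>v\<in>pverts G - K. degree G v) \<longleftrightarrow>
         induces_clique G K \<and> induces_stable G (pverts G - K)"
proof -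
  note arcs = pair_graph_arcs[OF G]
  let ?S = "pverts G - K" and ?E = "parcs G"
  let ?N = "{(u, w). u \<in> K \<and> w \<in> K \<and> u \<noteq> w \<and> (u, w) \<notin> ?E}"
  have finK: "finite K"
    using K arcs(1) finite_subset by blast
  have "?E \<subseteq> pverts G \<times> pverts G"
    using arcs(2,3) by auto
  hence finE: "finite ?E"
    using arcs(1) finite_subset by blast
  have finN: "finite ?N"
    by (rule finite_subset[of _ "K \<times> K"]) (use finK in auto)
  have deg: "(\<Sum>v\<in>T. degree G v) = card (?E \<inter> T \<times> K) + card (?E \<inter> T \<times> ?S)"
    if "T \<subseteq> pverts G" for T
  proof -
    have "?E \<inter> T \<times> pverts G = (?E \<inter> T \<times> K) \<union> (?E \<inter> T \<times> ?S)"
      using K by auto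
    moreover have "card \<dots> = card (?E \<inter> T \<times> K) + card (?E \<inter> T \<times> ?S)"
      using finE by (intro card_Un_disjoint) auto
    ultimately show ?thesis
      unfolding sum_degree_eq_card_arcs[OF G that] by simp
  qed
  have "?E \<inter> K \<times> ?S = (?E \<inter> ?S \<times> K)\<inverse>"
    using arcs(5) by auto
  hence cross: "card (?E \<inter> K \<times> ?S) = card (?E \<inter> ?S \<times> K)"
    by (simp only: card_inverse)
  \<comment> \<open>Ordered pairs in \<open>K\<close> are arcs, missing arcs or diagonal; dropping
    the diagonal leaves |K|(|K| - 1).\<close>
  have "K \<times> K = (?E \<inter> K \<times> K \<union> ?N) \<union> (\<lambda>v. (v, v)) ` K"
    using arcs(4) by auto
  also have "card \<dots> = card (?E \<inter> K \<times> K \<union> ?N) + card ((\<lambda>v. (v, v)) ` K)"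
    using arcs(4) finE finN finK by (intro card_Un_disjoint) auto
  also have "card (?E \<inter> K \<times> K \<union> ?N) = card (?E \<inter> K \<times> K) + card ?N"
    using finE finN by (intro card_Un_disjoint) auto
  finally have "card K * (card K - 1) = card (?E \<inter> K \<times> K) + card ?N"
    by (simp add: card_image inj_on_def card_cartesian_product diff_mult_distrib2)
  hence "(\<Sum>v\<in>K. degree G v) = card K * (card K - 1) + (\<Sum>v\<in>?S. degree G v) \<longleftrightarrow>
      card ?N = 0 \<and> card (?E \<inter> ?S \<times> ?S) = 0"
    using deg[OF K] deg[of ?S] cross by auto
  also have "\<dots> \<longleftrightarrow> ?N = {} \<and> ?E \<inter> ?S \<times> ?S = {}"
    using finE finN by simp
  also have "\<dots> \<longleftrightarrow> induces_clique G K \<and> induces_stable G ?S"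
    unfolding induces_clique_def induces_stable_def by blast
  finally show ?thesis .
qed

text \<open>The clique already supplies |K| - 1 neighbours of \<open>x\<close>, so none lie outside
  \<open>K\<close>.\<close>

lemma clique_vertex_nbrs:
  assumes "pair_graph G" "K \<subseteq> pverts G" "induces_clique G K"
    and "x \<in> K" "degree G x = card K - 1"
  shows "{w. (x, w) \<in> parcs G} = K - {x}"
proof (rule sym, rule card_subset_eq)
  show "finite {w. (x, w) \<in> parcs G}"
    using pair_graph_arcs(1,3)[OF assms(1)] by (auto intro: finite_subset)
  show "K - {x} \<subseteq> {w. (x, w) \<in> parcs G}"
    using assms(3,4) by (auto simp: induces_clique_def)
  show "card (K - {x}) = card {w. (x, w) \<in> parcs G}"
    using assms(4,5) by (simp add: degree_eq_card)
qed

text \<open>\<open>x\<close> has no neighbour outside \<open>K\<close>, so the clique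
  \<open>K\<close> and the stable set \<open>?T\<close> meet exactly in \<open>x\<close> and their
  sizes sum to n + 1. In \<open>G\<close> and in the complement, the clique bound and the bound from
  merging a stable set then coincide.\<close>

lemma split_graph_NG:
  assumes G: "pair_graph G" and K: "K \<subseteq> pverts G"
    and clique: "induces_clique G K" and stable: "induces_stable G (pverts G - K)"
    and x: "x \<in> K" "degree G x = card K - 1"
  shows "chromatic_number G = card K" "NG_graph G"
    "induces_stable G (insert x (pverts G - K))"
proof -
  note arcs = pair_graph_arcs[OF G]
  note G' = pair_graph_complement[OF G]
  let ?T = "insert x (pverts G - K)"
  have finK: "finite K"
    using K arcs(1) finite_subset by blast
  have T: "?T \<subseteq> pverts G"
    using x(1) K by auto
  have card_T: "card ?T + card K = card (pverts G) + 1"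
    using x(1) finK arcs(1) K card_mono[OF arcs(1) K] by (simp add: card_Diff_subset)
  show stable_T: "induces_stable G ?T"
    using stable clique_vertex_nbrs[OF G K clique x] arcs(4,5)
    unfolding induces_stable_def by blast
  have clique_T: "induces_clique (complement G) ?T"
    using stable_T T by (auto simp: induces_clique_def induces_stable_def)
  have stable_K: "induces_stable (complement G) K"
    using clique by (auto simp: induces_clique_def induces_stable_def)
  have "chromatic_number G + card ?T \<le> card (pverts G) + 1"
    by (rule chromatic_number_add_card_stable_le[OF G _ _ T _ stable_T]) auto
  moreover have "chromatic_number (complement G) + card K \<le> card (pverts G) + 1"
    using chromatic_number_add_card_stable_le[OF G', of "pverts G" K] K x(1) stable_K by auto
  moreover have "card K \<le> chromatic_number G"
    by (rule card_clique_le_chromatic_number[OF G K clique])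
  moreover have "card ?T \<le> chromatic_number (complement G)"
    using card_clique_le_chromatic_number[OF G' _ clique_T] T by simp
  ultimately show "chromatic_number G = card K" "NG_graph G"
    using card_T unfolding NG_graph_def by linarith+
qed

section \<open>Degree sequences\<close>

text \<open>For a non-increasing sequence, the indices whose value passes a threshold form such a
  set, so their number determines them.\<close>

lemma down_closed_eq_atLeastAtMost_card:
  fixes J :: "nat set"
  assumes "finite J" "0 \<notin> J" "\<And>i j. j \<in> J \<Longrightarrow> 1 \<le> i \<Longrightarrow> i \<le> j \<Longrightarrow> i \<in> J"
  shows "J = {1..card J}"
proof (cases "J = {}")
  case False
  have "J = {1..Max J}"
  proof
    show "J \<subseteq> {1..Max J}"
      using assms(1,2) by (auto simp: Suc_le_eq intro: gr0I)
    show "{1..Max J} \<subseteq> J"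
      using assms(3)[OF Max_in[OF assms(1) False]] by auto
  qed
  thus ?thesis
    by (metis card_atLeastAtMost diff_Suc_1 Suc_eq_plus1)
qed simp

theorem theorem3p4:
  fixes G :: "'a pair_pre_digraph" and n m :: nat and d :: "nat \<Rightarrow> nat"
  assumes "pair_graph G"
    and "pverts G \<noteq> {}"
    and "n = card (pverts G)"
    and "degree_sequence G n d"
    and "m = Max {i \<in> {1..n}. d i \<ge> i - 1}"
  shows "(NG1_graph G \<longleftrightarrow>
            (\<Sum>i = 1..m. d i) = m * (m - 1) + (\<Sum>i = m + 1..n. d i) \<and>
            (d m = m - 1 \<and> m = Max {i \<in> {1..n}. d i = m - 1})) \<and>
         (NG2_graph G \<longleftrightarrow>
            (\<Sum>i = 1..m. d i) = m * (m - 1) + (\<Sum>i = m + 1..n. d i) \<and>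
            (d m = m - 1 \<and> m = Min {i \<in> {1..n}. d i = m - 1}))"
proof -
  note G = assms(1)
  note arcs = pair_graph_arcs[OF G]
  obtain v where bij: "bij_betw v {1..n} (pverts G)"
    and dv: "\<And>i. i \<in> {1..n} \<Longrightarrow> d i = degree G (v i)"
    and mono: "\<And>i j. i \<in> {1..n} \<Longrightarrow> j \<in> {1..n} \<Longrightarrow> i \<le> j \<Longrightarrow> d j \<le> d i"
    using assms(4) unfolding degree_sequence_def by blast
  have n: "n \<ge> 1"
    using assms(2,3) arcs(1) by (simp add: Suc_le_eq card_gt_0_iff)
  have inj: "inj_on v {1..n}" and img: "v ` {1..n} = pverts G"
    using bij by (auto simp: bij_betw_def)
  let ?M = "{i \<in> {1..n}. d i \<ge> i - 1}"
  \<comment> \<open>The index 1 always qualifies, as its bound is 0; hence the maximum defining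
    \<open>m\<close> is over a nonempty set.\<close>
  have "1 \<in> ?M"
    using n by simp
  hence "m \<in> ?M"
    unfolding assms(5) by (intro Max_in) auto
  hence m: "m \<in> {1..n}" "1 \<le> m" "m \<le> n"
    by auto
  have card_Collect: "card {u \<in> pverts G. P (degree G u)} = card {i \<in> {1..n}. P (d i)}"
    and Collect_eq: "{u \<in> pverts G. P (degree G u)} = v ` {i \<in> {1..n}. P (d i)}" for P
  proof -
    show *: "{u \<in> pverts G. P (degree G u)} = v ` {i \<in> {1..n}. P (d i)}"
      unfolding img[symmetric] using dv by auto
    show "card {u \<in> pverts G. P (degree G u)} = card {i \<in> {1..n}. P (d i)}"
      unfolding * by (intro card_image inj_on_subset[OF inj]) auto
  qed
  \<comment> \<open>\<open>K\<close> collects the first \<open>m\<close> vertices in order of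
    degree; condition (1) will say that it is a clique with stable rest.\<close>
  define K where "K = v ` {1..m}"
  have K: "K \<subseteq> pverts G"
    unfolding K_def img[symmetric] using m by auto
  have rest: "pverts G - K = v ` {m + 1..n}"
  proof -
    have "pverts G - K = v ` ({1..n} - {1..m})"
      unfolding K_def img[symmetric] using inj m by (intro inj_on_image_set_diff[symmetric]) auto
    also have "{1..n} - {1..m} = {m + 1..n}"
      by auto
    finally show ?thesis .
  qed
  have cardK: "card K = m"
    unfolding K_def using card_image[OF inj_on_subset[OF inj], of "{1..m}"] m by simp
  have sums: "(\<Sum>u\<in>v ` {i..j}. degree G u) = (\<Sum>i = i..j. d i)" if "1 \<le> i" "j \<le> n" for i j
    using that dv
    by (subst sum.reindex[OF inj_on_subset[OF inj]]) (auto intro!: sum.cong)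
  have split_iff: "(\<Sum>i = 1..m. d i) = m * (m - 1) + (\<Sum>i = m + 1..n. d i) \<longleftrightarrow>
      induces_clique G K \<and> induces_stable G (pverts G - K)"
    using split_iff_sum_degree[OF G K] sums[of 1 m] sums[of "m + 1" n] m
    unfolding rest cardK by (simp add: K_def)
  have vm: "v m \<in> K" "d m = degree G (v m)"
    using m dv by (auto simp: K_def)
  \<comment> \<open>An index i > k has \<open>d i\<close> \<le> k - 1 < i - 1, so it cannot compete
    for the maximum.\<close>
  have m_eqI: "m = k" if "k \<in> {1..n}" "k - 1 \<le> d k" "\<And>i. i \<in> {1..n} \<Longrightarrow> k < i \<Longrightarrow> d i \<le> k - 1"
    for k
    unfolding assms(5)
  proof (rule Max_eqI)
    show "i \<le> k" if "i \<in> ?M" for i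
    proof (rule ccontr)
      assume "\<not> i \<le> k"
      hence "d i \<le> k - 1" "i - 1 \<le> d i" "k < i"
        using \<open>\<And>i. i \<in> {1..n} \<Longrightarrow> k < i \<Longrightarrow> d i \<le> k - 1\<close> that by auto
      thus False
        using \<open>k \<in> {1..n}\<close> by auto
    qed
  qed (use that in auto)
  have A_eq: "ABC_A G = v ` {i \<in> {1..n}. d i = chromatic_number G - 1}"
    unfolding ABC_A_def by (rule Collect_eq)
  let ?k = "chromatic_number G"
  have NG1: "NG1_graph G \<longleftrightarrow> (induces_clique G K \<and> induces_stable G (pverts G - K)) \<and>
      (d m = m - 1 \<and> m = Max {i \<in> {1..n}. d i = m - 1})" (is "_ \<longleftrightarrow> ?R")
  proof
    assume "NG1_graph G"
    note str = NG1_structure[OF G this]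
    \<comment> \<open>These are the indices of A \<union> B: an initial segment, of length \<chi>(G)
      by \<open>NG1_structure\<close>.\<close>
    let ?J = "{i \<in> {1..n}. ?k - 1 \<le> d i}"
    have "?J = {1..card ?J}"
      by (rule down_closed_eq_atLeastAtMost_card) (auto intro: order_trans[OF _ mono])
    hence J: "?J = {1..?k}"
      using str(2) card_Collect[of "\<lambda>e. ?k - 1 \<le> e"] by simp
    obtain i where i: "i \<in> {1..n}" "d i = ?k - 1"
      using str(1) A_eq by auto
    hence "i \<in> ?J"
      by simp
    hence i': "1 \<le> i" "i \<le> ?k"
      unfolding J by auto
    hence "?k \<in> ?J"
      unfolding J by auto
    hence k: "?k \<in> {1..n}" "?k - 1 \<le> d ?k"
      by auto
    \<comment> \<open>A vertex of A sits at or before index \<open>?k\<close>, so monotonicity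
      bounds \<open>d ?k\<close> above; membership in \<open>?J\<close> bounds it below.\<close>
    have dk: "d ?k = ?k - 1"
      using mono[OF i(1) k(1) i'(2)] i(2) k(2) by simp
    have above: "i \<le> ?k" if "i \<in> {1..n}" "?k - 1 \<le> d i" for i
      using J that by auto
    have "d i \<le> ?k - 1" if "i \<in> {1..n}" "?k < i" for i
      using above[OF that(1)] that(2) by linarith
    hence mk: "m = ?k"
      by (intro m_eqI k) auto
    have KD: "{u \<in> pverts G. ?k - 1 \<le> degree G u} = K"
      unfolding Collect_eq[of "\<lambda>e. ?k - 1 \<le> e"] J by (simp add: K_def mk)
    have "Max {i \<in> {1..n}. d i = m - 1} = m"
      using above k(1) dk mk by (intro Max_eqI) auto
    thus ?R
      using str(3,4) dk mk unfolding KD by simp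
  next
    assume R: ?R
    hence clique: "induces_clique G K" and stable: "induces_stable G (pverts G - K)"
      by auto
    have "degree G (v m) = card K - 1"
      using R vm cardK by simp
    note sp = split_graph_NG[OF G K clique stable vm(1) this]
    have "i \<le> m" if "i \<in> {1..n}" "d i = m - 1" for i
    proof -
      have "i \<le> Max {i \<in> {1..n}. d i = m - 1}"
        using that by (intro Max_ge) auto
      thus ?thesis
        using R by argo
    qed
    \<comment> \<open>Being the largest index puts all of A into the first \<open>m\<close> places,
      hence into the clique \<open>K\<close>.\<close>
    hence "ABC_A G \<subseteq> K"
      unfolding A_eq sp(1) cardK unfolding K_def by auto
    hence "induces_clique G (ABC_A G)"
      using clique unfolding induces_clique_def by blast
    thus "NG1_graph G"
      using sp(2) by (simp add: NG1_graph_def)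
  qed
  have NG2: "NG2_graph G \<longleftrightarrow> (induces_clique G K \<and> induces_stable G (pverts G - K)) \<and>
      (d m = m - 1 \<and> m = Min {i \<in> {1..n}. d i = m - 1})" (is "_ \<longleftrightarrow> ?R")
  proof
    assume "NG2_graph G"
    note str = NG2_structure[OF G this]
    \<comment> \<open>The inequality is now strict: these are the indices of B, an initial segment
      of length only \<chi>(G) - 1.\<close>
    let ?J = "{i \<in> {1..n}. ?k - 1 < d i}"
    have "?J = {1..card ?J}"
      by (rule down_closed_eq_atLeastAtMost_card) (auto intro: less_le_trans[OF _ mono])
    moreover have "card ?J = ?k - 1"
      using str(2) card_Collect[of "\<lambda>e. ?k - 1 < e"] by simp
    ultimately have J: "?J = {1..?k - 1}"
      by simp
    have k1: "1 \<le> ?k"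
      using str(2) by simp
    obtain i where i: "i \<in> {1..n}" "d i = ?k - 1"
      using str(1) A_eq by auto
    have below: "?k \<le> i" if "i \<in> {1..n}" "d i \<le> ?k - 1" for i
    proof (rule ccontr)
      assume "\<not> ?k \<le> i"
      hence "i \<in> {1..?k - 1}"
        using that(1) by auto
      thus False
        unfolding J[symmetric] using that(2) by simp
    qed
    have le: "d i \<le> ?k - 1" if "i \<in> {1..n}" "?k \<le> i" for i
    proof (rule ccontr)
      assume "\<not> d i \<le> ?k - 1"
      hence "i \<in> {1..?k - 1}"
        unfolding J[symmetric] using that(1) by simp
      thus False
        using that k1 by auto
    qed
    \<comment> \<open>The vertex of A comes after all of B; this also shows that index
      \<open>?k\<close> does not exceed \<open>n\<close>.\<close>
    have ki: "?k \<le> i"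
      using below i by simp
    hence k: "?k \<in> {1..n}"
      using k1 i(1) by auto
    have dk: "d ?k = ?k - 1"
      using mono[OF k i(1) ki] i(2) le[OF k] by simp
    have mk: "m = ?k"
      using le dk by (intro m_eqI k) auto
    let ?B = "{u \<in> pverts G. ?k - 1 < degree G u}"
    have B: "?B = v ` {1..?k - 1}"
      unfolding Collect_eq[of "\<lambda>e. ?k - 1 < e"] J ..
    have "{1..m} = insert m {1..?k - 1}"
      using mk k1 by auto
    \<comment> \<open>\<open>K\<close> is B together with the first vertex after it, which belongs
      to A.\<close>
    hence KB: "K = insert (v m) ?B"
      unfolding K_def B by simp
    have "pverts G - K \<subseteq> pverts G - ?B"
      using KB by auto
    hence stable: "induces_stable G (pverts G - K)"
      using str(4) unfolding induces_stable_def by blast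
    have degm: "degree G (v m) = ?k - 1"
      using vm(2) dk mk by simp
    have "v m \<in> pverts G - ?B"
      using vm(1) K degm by auto
    \<comment> \<open>\<open>v m\<close> lies in the stable set outside B, so its \<chi>(G) - 1 =
      |B| neighbours must be all of B.\<close>
    hence "{w. (v m, w) \<in> parcs G} \<subseteq> ?B"
      using str(4) arcs(3) unfolding induces_stable_def by blast
    moreover have "card {w. (v m, w) \<in> parcs G} = card ?B"
      using degm str(2) by (simp add: degree_eq_card)
    ultimately have "{w. (v m, w) \<in> parcs G} = ?B"
      using arcs(1) by (intro card_subset_eq) auto
    hence "induces_clique G K"
      using str(3) arcs(5) unfolding KB induces_clique_def by blast
    moreover have "Min {i \<in> {1..n}. d i = m - 1} = m"
      using below k dk mk by (intro Min_eqI) auto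
    ultimately show ?R
      using stable dk mk by simp
  next
    assume R: ?R
    hence clique: "induces_clique G K" and stable: "induces_stable G (pverts G - K)"
      by auto
    have "degree G (v m) = card K - 1"
      using R vm cardK by simp
    note sp = split_graph_NG[OF G K clique stable vm(1) this]
    have "m \<le> i" if "i \<in> {1..n}" "d i = m - 1" for i
    proof -
      have "Min {i \<in> {1..n}. d i = m - 1} \<le> i"
        using that by (intro Min_le) auto
      thus ?thesis
        using R by argo
    qed
    \<comment> \<open>Being the smallest index puts A at places \<open>m\<close> and later:
      \<open>v m\<close> and the rest, which together are stable by
      \<open>split_graph_NG\<close>.\<close>
    hence "ABC_A G \<subseteq> v ` insert m {m + 1..n}"
      unfolding A_eq sp(1) cardK by fastforce
    hence "ABC_A G \<subseteq> insert (v m) (pverts G - K)"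
      unfolding rest by simp
    hence "induces_stable G (ABC_A G)"
      using sp(3) unfolding induces_stable_def by blast
    thus "NG2_graph G"
      using sp(2) by (simp add: NG2_graph_def)
  qed
  show ?thesis
    unfolding split_iff using NG1 NG2 by blast
qed

end
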